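(* Let $N,n\ge 1$ be integers, let $A_i\in\mathbf{R}^{n\times n}$ and $\tau_i>0$, $i\in\mathbf{I}[1,N]$. Consider the following four solvability conditions. (a) There exist positive definite matrices $P,Q_i\in\mathbf{R}^{n\times n}$, $i\in\mathbf{I}[1,N]$, such that $$N\tau_iA_i^{\mathrm{T}}\Big(P+\sum_{j=1}^{N}\tau_jQ_j\Big)A_i-Q_i<0,\quad i\in\mathbf{I}[1,N].$$ (a') There exist positive definite matrices $Q_i\in\mathbf{R}^{n\times n}$, $i\in\mathbf{I}[1,N]$, such that $$N\tau_i^{2}A_i^{\mathrm{T}}\Big(\sum_{j=1}^{N}Q_j\Big)A_i-Q_i<0,\quad i\in\mathbf{I}[1,N].$$ (b) There exist positive definite matrices $S_i,Q_i\in\mathbf{R}^{n\times n}$, $i\in\mathbf{I}[1,N]$, and a matrix $R\in\mathbf{R}^{n\times n}$ such that $$\sum_{i=1}^{N}Q_i+\sum_{i=1}^{N}S_i-\left(R^{\mathrm{T}}+R\right)<0\quad\text{and}\quad\begin{bmatrix}-S_i & \tau_iA_i^{\mathrm{T}}R\\ \tau_iR^{\mathrm{T}}A_i & -Q_i\end{bmatrix}<0,\quad i\in\mathbf{I}[1,N].$$ (c) There exist positive definite matrices $Q_i\in\mathbf{R}^{n\times n}$, $i\in\mathbf{I}[1,N]$, such that $$\sum_{i=1}^{N}\begin{bmatrix}\tau_1A_1\\ \vdots\\ \tau_NA_N\end{bmatrix}Q_i\begin{bmatrix}\tau_1A_1\\ \vdots\\ \tau_NA_N\end{bmatrix}^{\mathrm{T}}-\begin{bmatrix}Q_1&&\\&\ddots&\\&&Q_N\end{bmatrix}<0.$$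 Then: 1. If (a) (or (a')) holds, then (b) holds. 2. (b) holds if and only if (c) holds. Hence if (a) holds, then both (b) and (c) hold.
   Context: Notation: $\mathbf{I}[1,N]=\{1,2,\ldots,N\}$. Positive definite matrices are real symmetric; for a symmetric matrix, $X<0$ means that $-X$ is positive definite. The last matrix in (c) is block diagonal with diagonal blocks $Q_1,\ldots,Q_N$. *)

theory Defs
  imports "HOL-Analysis.Analysis"
begin

definition pos_def :: "real ^ 'a ^ 'a \<Rightarrow> bool" where
  "pos_def X \<longleftrightarrow> transpose X = X \<and> (\<forall>v. v \<noteq> 0 \<longrightarrow> v \<bullet> (X *v v) > 0)"

definition neg_def :: "real ^ 'a ^ 'a \<Rightarrow> bool" where
  "neg_def X \<longleftrightarrow> pos_def (- X)"

text \<open>Block matrices are indexed by sums (two blocks, of possibly different sizes) or by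
  products (a family of equally sized blocks); the index \<open>(i, r)\<close> stands for position
  \<open>r\<close> within block \<open>i\<close>.\<close>

definition block2 ::
  "real ^ 'a ^ 'c \<Rightarrow> real ^ 'b ^ 'c \<Rightarrow> real ^ 'a ^ 'd \<Rightarrow> real ^ 'b ^ 'd
    \<Rightarrow> real ^ ('a + 'b) ^ ('c + 'd)" where
  "block2 W X Y Z = (\<chi> r c.
     case r of
       Inl i \<Rightarrow> (case c of Inl j \<Rightarrow> W $ i $ j | Inr j \<Rightarrow> X $ i $ j)
     | Inr i \<Rightarrow> (case c of Inl j \<Rightarrow> Y $ i $ j | Inr j \<Rightarrow> Z $ i $ j))"

definition block_column :: "('k::finite \<Rightarrow> real ^ 'b ^ 'a) \<Rightarrow> real ^ 'b ^ ('k \<times> 'a)" where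
  "block_column M = (\<chi> r c. M (fst r) $ snd r $ c)"

definition block_diag :: "('k::finite \<Rightarrow> real ^ 'a ^ 'a) \<Rightarrow> real ^ ('k \<times> 'a) ^ ('k \<times> 'a)" where
  "block_diag M = (\<chi> r c. if fst r = fst c then M (fst r) $ snd r $ snd c else 0)"

text \<open>The finite types \<open>'k\<close> and \<open>'n\<close> play the roles of \<open>{1, \<dots>, N}\<close> and \<open>{1, \<dots>, n}\<close>,
  so that \<open>N = CARD('k)\<close> and \<open>n = CARD('n)\<close>.\<close>

definition cond_a :: "('k::finite \<Rightarrow> real ^ 'n ^ 'n) \<Rightarrow> ('k \<Rightarrow> real) \<Rightarrow> bool" where
  "cond_a A \<tau> \<longleftrightarrow> (\<exists>P Q. pos_def P \<and> (\<forall>i. pos_def (Q i)) \<and>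
     (\<forall>i. neg_def ((real CARD('k) * \<tau> i) *\<^sub>R
        (transpose (A i) ** (P + (\<Sum>j\<in>UNIV. \<tau> j *\<^sub>R Q j)) ** A i) - Q i)))"

definition cond_a' :: "('k::finite \<Rightarrow> real ^ 'n ^ 'n) \<Rightarrow> ('k \<Rightarrow> real) \<Rightarrow> bool" where
  "cond_a' A \<tau> \<longleftrightarrow> (\<exists>Q. (\<forall>i. pos_def (Q i)) \<and>
     (\<forall>i. neg_def ((real CARD('k) * (\<tau> i)\<^sup>2) *\<^sub>R
        (transpose (A i) ** (\<Sum>j\<in>UNIV. Q j) ** A i) - Q i)))"

definition cond_b :: "('k::finite \<Rightarrow> real ^ 'n ^ 'n) \<Rightarrow> ('k \<Rightarrow> real) \<Rightarrow> bool" where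
  "cond_b A \<tau> \<longleftrightarrow> (\<exists>S Q R. (\<forall>i. pos_def (S i)) \<and> (\<forall>i. pos_def (Q i)) \<and>
     neg_def ((\<Sum>i\<in>UNIV. Q i) + (\<Sum>i\<in>UNIV. S i) - (transpose R + R)) \<and>
     (\<forall>i. neg_def (block2
        (- S i) (\<tau> i *\<^sub>R (transpose (A i) ** R))
        (\<tau> i *\<^sub>R (transpose R ** A i)) (- Q i))))"

definition cond_c :: "('k::finite \<Rightarrow> real ^ 'n ^ 'n) \<Rightarrow> ('k \<Rightarrow> real) \<Rightarrow> bool" where
  "cond_c A \<tau> \<longleftrightarrow> (\<exists>Q. (\<forall>i. pos_def (Q i)) \<and>
     neg_def ((\<Sum>i\<in>UNIV. block_column (\<lambda>j. \<tau> j *\<^sub>R A j) ** Q i **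
                transpose (block_column (\<lambda>j. \<tau> j *\<^sub>R A j)))
       - block_diag Q))"

end

theory Submission
  imports Defs
begin

text \<open>
  Write \<open>B\<^sub>i = \<tau>\<^sub>i A\<^sub>i\<close> and read every matrix inequality as a strict inequality between
  quadratic forms. The block inequalities then become statements about families of vectors
  (\<open>neg_def_block2_iff\<close>, \<open>neg_def_block_column_iff\<close>). The Schur complement arguments that relate
  the conditions turn into substitutions of suitable vectors, combined where an inverse or a
  completion of squares is involved with \<open>2 (x \<bullet> Q y) \<le> x \<bullet> Q x + y \<bullet> Q y\<close> for \<open>Q > 0\<close>
  (\<open>pos_def_young\<close>, \<open>pos_def_young_dual\<close>).

  In (b), "sum inequality" refers to the bound on \<open>\<Sum>\<^sub>i Q\<^sub>i + \<Sum>\<^sub>i S\<^sub>i\<close> and "block inequality"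
  to the other one.

  From (a) to (a'): replace \<open>Q\<^sub>j\<close> by \<open>\<tau>\<^sub>j Q\<^sub>j\<close> and drop \<open>P\<close>, whose contribution is nonnegative.

  From (a') to (b): let \<open>Z = \<Sum>\<^sub>j Q\<^sub>j\<close>. Condition (b) is solved by \<open>R = Z\<close>, by \<open>Z / N\<close> in place
  of each \<open>Q\<^sub>i\<close>, and by \<open>S\<^sub>i = Q\<^sub>i - M\<^sub>i / 2\<close>, where \<open>M\<^sub>i = Q\<^sub>i - N B\<^sub>i\<^sup>T Z B\<^sub>i > 0\<close> is the slack
  in (a'). One half of the slack makes the block inequality strict, the other half makes the sum
  inequality strict.

  From (b) to (c): the sum inequality forces \<open>R\<close> to be invertible, and the congruent matrices
  \<open>R\<^sup>-\<^sup>T Q\<^sub>i R\<^sup>-\<^sup>1\<close> solve (c). For vectors \<open>x\<^sub>i = R v\<^sub>i\<close> and \<open>y = \<Sum>\<^sub>i B\<^sub>i\<^sup>T x\<^sub>i = R u\<close>,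
  summing the block inequalities at \<open>(u, v\<^sub>i)\<close> bounds \<open>2 (u \<bullet> R u) = 2 (u \<bullet> y)\<close>
  from above, and the sum inequality at \<open>u\<close> bounds it from below.

  From (c) to (b): let \<open>W = \<Sum>\<^sub>i Q\<^sub>i\<close>. Condition (c) says that \<open>B W B\<^sup>T\<close> lies below the block
  diagonal \<open>D\<close> of the \<open>Q\<^sub>i\<close>; dually \<open>X = \<Sum>\<^sub>i B\<^sub>i\<^sup>T Q\<^sub>i\<^sup>-\<^sup>1 B\<^sub>i = B\<^sup>T D\<^sup>-\<^sup>1 B\<close> lies below \<open>W\<^sup>-\<^sup>1\<close>.
  So \<open>R = W\<^sup>-\<^sup>1\<close>, the congruent matrices \<open>R Q\<^sub>i R\<close> (whose sum is \<open>R\<close>), and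
  \<open>S\<^sub>i = B\<^sub>i\<^sup>T Q\<^sub>i\<^sup>-\<^sup>1 B\<^sub>i + (W\<^sup>-\<^sup>1 - X) / (2 N)\<close> solve (b), the slack \<open>W\<^sup>-\<^sup>1 - X\<close> being shared out
  so that half of it is left for the sum inequality.
\<close>

section \<open>Matrix algebra and quadratic forms\<close>

text \<open>The simplifier would turn \<open>transpose X *v y\<close> into \<open>y v* X\<close>; below, a transpose stays in
  place until \<open>inner_transpose_right\<close> moves it to the other side of an inner product.\<close>

declare transpose_matrix_vector [simp del]

lemma transpose_add: "transpose (X + Y :: real ^ 'a ^ 'b) = transpose X + transpose Y"
  by (simp add: transpose_def vec_eq_iff)

lemma transpose_diff: "transpose (X - Y :: real ^ 'a ^ 'b) = transpose X - transpose Y"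
  by (simp add: transpose_def vec_eq_iff)

lemma transpose_minus: "transpose (- X :: real ^ 'a ^ 'b) = - transpose X"
  by (simp add: transpose_def vec_eq_iff)

lemma transpose_sum: "transpose (\<Sum>i\<in>I. X i :: real ^ 'a ^ 'b) = (\<Sum>i\<in>I. transpose (X i))"
  by (induction I rule: infinite_finite_induct)
    (simp_all add: transpose_add, simp_all add: transpose_def vec_eq_iff)

lemmas transpose_simps =
  transpose_add transpose_diff transpose_minus transpose_scalar transpose_sum matrix_transpose_mul

lemma minus_matrix_vector_mult: "(- X) *v v = - (X *v v)" for X :: "real ^ 'a ^ 'b"
  using matrix_vector_mult_diff_rdistrib[of 0 X v] by simp

lemma sum_matrix_vector_mult:
  "(\<Sum>i\<in>I. X i) *v v = (\<Sum>i\<in>I. X i *v v)" for X :: "'i \<Rightarrow> real ^ 'a ^ 'b"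
  by (induction I rule: infinite_finite_induct) (simp_all add: matrix_vector_mult_add_rdistrib)

lemmas matrix_vector_simps =
  matrix_vector_mult_add_rdistrib matrix_vector_mult_diff_rdistrib minus_matrix_vector_mult
  sum_matrix_vector_mult scaleR_matrix_vector_assoc[symmetric]
  matrix_vector_mul_assoc[symmetric]

lemma inner_transpose_right: "x \<bullet> (transpose X *v y) = (X *v x) \<bullet> y" for X :: "real ^ 'a ^ 'b"
  by (metis dot_lmul_matrix inner_commute transpose_matrix_vector)

lemma inner_symmetric_matrix:
  fixes X :: "real ^ 'a ^ 'a"
  assumes "transpose X = X"
  shows "x \<bullet> (X *v y) = (X *v x) \<bullet> y"
  using inner_transpose_right[of x X y] assms by simp

lemma neg_def_iff:
  "neg_def X \<longleftrightarrow> transpose X = X \<and> (\<forall>v. v \<noteq> 0 \<longrightarrow> v \<bullet> (X *v v) < 0)"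
  by (simp add: neg_def_def pos_def_def transpose_minus minus_matrix_vector_mult)

lemma pos_def_symmetric: "pos_def X \<Longrightarrow> transpose X = X"
  by (simp add: pos_def_def)

lemma pos_def_pos: "pos_def X \<Longrightarrow> v \<noteq> 0 \<Longrightarrow> 0 < v \<bullet> (X *v v)"
  by (simp add: pos_def_def)

lemma pos_def_nonneg: "pos_def X \<Longrightarrow> 0 \<le> v \<bullet> (X *v v)"
  by (cases "v = 0") (auto dest: pos_def_pos intro: less_imp_le)

lemma pos_def_scaleR: "pos_def X \<Longrightarrow> 0 < c \<Longrightarrow> pos_def (c *\<^sub>R X)"
  by (simp add: pos_def_def transpose_simps matrix_vector_simps)

lemma pos_def_sum:
  fixes Q :: "'k::finite \<Rightarrow> real ^ 'n ^ 'n"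
  assumes "\<And>i. pos_def (Q i)"
  shows "pos_def (\<Sum>i\<in>UNIV. Q i)"
  using assms by (auto simp: pos_def_def transpose_simps matrix_vector_simps inner_sum_right
      intro!: sum_pos)

text \<open>This expands \<open>0 \<le> (x - y) \<bullet> Q (x - y)\<close>.\<close>

lemma pos_def_young:
  assumes "pos_def Q"
  shows "2 * (x \<bullet> (Q *v y)) \<le> x \<bullet> (Q *v x) + y \<bullet> (Q *v y)"
proof -
  have "y \<bullet> (Q *v x) = x \<bullet> (Q *v y)"
    using inner_symmetric_matrix[OF pos_def_symmetric[OF assms]] by (simp add: inner_commute)
  then show ?thesis
    using pos_def_nonneg[OF assms, of "x - y"]
    by (simp add: matrix_vector_mult_diff_distrib inner_diff_left inner_diff_right)
qed

text \<open>A matrix with positive quadratic form, symmetric or not, has trivial kernel. The matrix \<open>R\<close>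
  of condition (b) is the intended instance.\<close>

lemma positive_form_inverse:
  fixes R :: "real ^ 'n ^ 'n"
  assumes "\<And>v. v \<noteq> 0 \<Longrightarrow> 0 < v \<bullet> (R *v v)"
  obtains T where "T ** R = mat 1" "R ** T = mat 1"
proof -
  have "\<forall>x. R *v x = 0 \<longrightarrow> x = 0"
    using assms by (metis inner_zero_right less_irrefl)
  then show thesis
    using that matrix_left_invertible_ker[of R] matrix_left_right_inverse by blast
qed

lemma pos_def_inverse:
  fixes Q :: "real ^ 'n ^ 'n"
  assumes "pos_def Q"
  shows "\<exists>T. pos_def T \<and> (\<forall>v. Q *v (T *v v) = v)"
proof -
  obtain T where T: "T ** Q = mat 1" "Q ** T = mat 1"
    using positive_form_inverse pos_def_pos[OF assms] by blast
  have sym: "transpose Q = Q"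
    using assms by (rule pos_def_symmetric)
  have "transpose T ** Q = mat 1"
    using arg_cong[OF T(2), of transpose] by (simp add: matrix_transpose_mul sym)
  then have sym_T: "transpose T = T"
    by (metis T(2) matrix_mul_assoc matrix_mul_lid matrix_mul_rid)
  have QT: "Q *v (T *v v) = v" for v
    using T(2) by (simp add: matrix_vector_mul_assoc)
  have "0 < v \<bullet> (T *v v)" if "v \<noteq> 0" for v
  proof -
    have "T *v v \<noteq> 0"
      using QT[of v] that by auto
    from pos_def_pos[OF assms this] show ?thesis
      by (simp add: QT inner_commute)
  qed
  with sym_T have "pos_def T"
    by (simp add: pos_def_def)
  then show ?thesis
    using QT by blast
qed

lemma pos_def_congruence:
  fixes Q T :: "real ^ 'n ^ 'n"
  assumes "pos_def Q" and "\<And>v. T *v v = 0 \<Longrightarrow> v = 0"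
  shows "pos_def (transpose T ** Q ** T)"
  using assms
  by (auto simp: pos_def_def transpose_simps matrix_mul_assoc matrix_vector_simps
      inner_transpose_right)

text \<open>Here \<open>T\<close> is the inverse of \<open>Q\<close>. The inequality is \<open>pos_def_young\<close> at the vectors \<open>T x\<close>
  and \<open>y\<close>; it plays the part of a Schur complement.\<close>

lemma pos_def_young_dual:
  assumes "pos_def Q" and "\<And>v. Q *v (T *v v) = v"
  shows "2 * (x \<bullet> y) \<le> x \<bullet> (T *v x) + y \<bullet> (Q *v y)"
proof -
  have "(T *v x) \<bullet> (Q *v y) = x \<bullet> y"
    by (simp add: inner_symmetric_matrix[OF pos_def_symmetric[OF assms(1)]] assms(2))
  then show ?thesis
    using pos_def_young[OF assms(1), of "T *v x" y]
    by (simp add: assms(2) inner_commute[of "T *v x" x])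
qed

section \<open>Quadratic forms of block matrices\<close>

lemma sum_UNIV_sum_type:
  fixes f :: "'a::finite + 'b::finite \<Rightarrow> real"
  shows "(\<Sum>r\<in>UNIV. f r) = (\<Sum>i\<in>UNIV. f (Inl i)) + (\<Sum>i\<in>UNIV. f (Inr i))"
  by (simp add: UNIV_Plus_UNIV[symmetric] sum.Plus del: UNIV_Plus_UNIV)

lemma sum_UNIV_prod_type:
  fixes f :: "'a::finite \<times> 'b::finite \<Rightarrow> real"
  shows "(\<Sum>r\<in>UNIV. f r) = (\<Sum>i\<in>UNIV. \<Sum>j\<in>UNIV. f (i, j))"
  by (simp add: UNIV_Times_UNIV[symmetric] sum.cartesian_product del: UNIV_Times_UNIV)

lemma inner_block2:
  fixes W :: "real ^ 'a ^ 'a" and Z :: "real ^ 'b ^ 'b"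
    and X :: "real ^ 'b ^ 'a" and Y :: "real ^ 'a ^ 'b" and w :: "real ^ ('a + 'b)"
  defines "u \<equiv> \<chi> i. w $ Inl i" and "v \<equiv> \<chi> i. w $ Inr i"
  shows "w \<bullet> (block2 W X Y Z *v w) =
    u \<bullet> (W *v u) + u \<bullet> (X *v v) + v \<bullet> (Y *v u) + v \<bullet> (Z *v v)"
  by (simp add: inner_vec_def matrix_vector_mult_def block2_def sum_UNIV_sum_type u_def v_def
      algebra_simps sum.distrib)

lemma transpose_block2:
  "transpose (block2 W X Y Z) =
    block2 (transpose W) (transpose Y) (transpose X) (transpose Z)"
  by (auto simp: transpose_def block2_def vec_eq_iff split: sum.split)

text \<open>A vector over the sum index is a pair of independent vectors, and the two off-diagonal
  blocks contribute the same number because they are transposes of each other.\<close>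

lemma neg_def_block2_iff:
  fixes S :: "real ^ 'a ^ 'a" and Q :: "real ^ 'b ^ 'b" and K :: "real ^ 'a ^ 'b"
  assumes "transpose S = S" and "transpose Q = Q"
  shows "neg_def (block2 (- S) (transpose K) K (- Q)) \<longleftrightarrow>
    (\<forall>u v. u \<noteq> 0 \<or> v \<noteq> 0 \<longrightarrow> 2 * ((K *v u) \<bullet> v) < u \<bullet> (S *v u) + v \<bullet> (Q *v v))"
    (is "neg_def ?M \<longleftrightarrow> ?R")
proof -
  have sym: "transpose ?M = ?M"
    using assms by (simp add: transpose_block2 transpose_minus)
  have form: "w \<bullet> (?M *v w) = 2 * ((K *v u) \<bullet> v) - (u \<bullet> (S *v u) + v \<bullet> (Q *v v))"
    if "u = (\<chi> i. w $ Inl i)" "v = (\<chi> i. w $ Inr i)" for u v w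
    unfolding inner_block2 that[symmetric]
    by (simp add: minus_matrix_vector_mult inner_transpose_right inner_commute)
  show ?thesis
  proof
    assume neg: "neg_def ?M"
    show ?R
    proof (intro allI impI)
      fix u :: "real ^ 'a" and v :: "real ^ 'b"
      assume "u \<noteq> 0 \<or> v \<noteq> 0"
      define w :: "real ^ ('a + 'b)" where
        "w = (\<chi> r. case r of Inl i \<Rightarrow> u $ i | Inr i \<Rightarrow> v $ i)"
      have u: "u = (\<chi> i. w $ Inl i)" and v: "v = (\<chi> i. w $ Inr i)"
        by (simp_all add: w_def vec_eq_iff)
      have "w \<noteq> 0"
        using \<open>u \<noteq> 0 \<or> v \<noteq> 0\<close> by (subst (asm) u, subst (asm) v) (auto simp: vec_eq_iff)
      with neg form[OF u v] show "2 * ((K *v u) \<bullet> v) < u \<bullet> (S *v u) + v \<bullet> (Q *v v)"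
        by (auto simp: neg_def_iff)
    qed
  next
    assume R: ?R
    have "w \<bullet> (?M *v w) < 0" if w: "w \<noteq> 0" for w
    proof -
      define u v where u: "u = (\<chi> i. w $ Inl i)" and v: "v = (\<chi> i. w $ Inr i)"
      obtain r where "w $ r \<noteq> 0"
        using w by (auto simp: vec_eq_iff)
      then have "u \<noteq> 0 \<or> v \<noteq> 0"
        by (cases r) (auto simp: u v vec_eq_iff)
      with R form[OF u v] show ?thesis
        by simp
    qed
    with sym show "neg_def ?M"
      by (simp add: neg_def_iff)
  qed
qed

lemma transpose_block_column_mult:
  fixes M :: "'k::finite \<Rightarrow> real ^ 'b ^ 'a" and x :: "real ^ ('k \<times> 'a)"
  shows "transpose (block_column M) *v x =
    (\<Sum>i\<in>UNIV. transpose (M i) *v (\<chi> r. x $ (i, r)))"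
  by (simp add: vec_eq_iff matrix_vector_mult_def transpose_def block_column_def
      sum_UNIV_prod_type)

lemma inner_block_diag:
  fixes M :: "'k::finite \<Rightarrow> real ^ 'a ^ 'a" and x :: "real ^ ('k \<times> 'a)"
  shows "x \<bullet> (block_diag M *v x) =
    (\<Sum>i\<in>UNIV. (\<chi> r. x $ (i, r)) \<bullet> (M i *v (\<chi> r. x $ (i, r))))"
proof -
  have "(\<Sum>j\<in>UNIV. \<Sum>s\<in>UNIV. (if i = j then M i $ r $ s else 0) * x $ (j, s)) =
      (\<Sum>s\<in>UNIV. M i $ r $ s * x $ (i, s))" for i r
  proof -
    have "(\<Sum>j\<in>UNIV. \<Sum>s\<in>UNIV. (if i = j then M i $ r $ s else 0) * x $ (j, s)) =
        (\<Sum>j\<in>UNIV. if i = j then \<Sum>s\<in>UNIV. M i $ r $ s * x $ (j, s) else 0)"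
      by (intro sum.cong) auto
    then show ?thesis
      by simp
  qed
  then show ?thesis
    by (simp add: inner_vec_def matrix_vector_mult_def block_diag_def sum_UNIV_prod_type
        cong: if_cong)
qed

lemma transpose_block_diag: "transpose (block_diag M) = block_diag (\<lambda>i. transpose (M i))"
  by (auto simp: transpose_def block_diag_def vec_eq_iff)

text \<open>A vector over the product index is a family \<open>x\<close> of independent vectors. Writing \<open>C\<close> for the
  block column, the quadratic form of \<open>C Q\<^sub>i C\<^sup>T\<close> depends only on \<open>y = C\<^sup>T x\<close>, so the
  matrices \<open>Q\<^sub>i\<close> enter on the left only through their sum.\<close>

lemma neg_def_block_column_iff:
  fixes B Q :: "'k::finite \<Rightarrow> real ^ 'n ^ 'n"
  assumes "\<And>i. transpose (Q i) = Q i"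
  shows "neg_def ((\<Sum>i\<in>UNIV. block_column B ** Q i ** transpose (block_column B))
      - block_diag Q) \<longleftrightarrow>
    (\<forall>x y. (\<exists>i. x i \<noteq> 0) \<longrightarrow> y = (\<Sum>i\<in>UNIV. transpose (B i) *v x i) \<longrightarrow>
      y \<bullet> ((\<Sum>i\<in>UNIV. Q i) *v y) < (\<Sum>i\<in>UNIV. x i \<bullet> (Q i *v x i)))"
    (is "neg_def ?M \<longleftrightarrow> ?R")
proof -
  have sym: "transpose ?M = ?M"
    by (simp add: transpose_simps transpose_block_diag assms matrix_mul_assoc)
  have form: "z \<bullet> (?M *v z) =
      y \<bullet> ((\<Sum>i\<in>UNIV. Q i) *v y) - (\<Sum>i\<in>UNIV. x i \<bullet> (Q i *v x i))"
    if x: "x = (\<lambda>i. \<chi> r. z $ (i, r))" and y: "y = (\<Sum>i\<in>UNIV. transpose (B i) *v x i)" for x y z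
  proof -
    have y': "transpose (block_column B) *v z = y"
      by (simp add: transpose_block_column_mult x y)
    have "z \<bullet> (block_column B *v v) = y \<bullet> v" for v
      using inner_transpose_right[of z "transpose (block_column B)" v] y' by simp
    then show ?thesis
      by (simp add: matrix_vector_simps inner_diff_right inner_sum_right inner_block_diag y' x)
  qed
  show ?thesis
  proof
    assume neg: "neg_def ?M"
    show ?R
    proof (intro allI impI)
      fix x :: "'k \<Rightarrow> real ^ 'n" and y
      assume "\<exists>i. x i \<noteq> 0" and y: "y = (\<Sum>i\<in>UNIV. transpose (B i) *v x i)"
      define z :: "real ^ ('k \<times> 'n)" where "z = (\<chi> r. x (fst r) $ snd r)"
      have x: "x = (\<lambda>i. \<chi> r. z $ (i, r))"
        by (simp add: z_def fun_eq_iff vec_eq_iff)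
      have "z \<noteq> 0"
        using \<open>\<exists>i. x i \<noteq> 0\<close> by (subst (asm) x) (auto simp: vec_eq_iff)
      with neg form[OF x y]
      show "y \<bullet> ((\<Sum>i\<in>UNIV. Q i) *v y) < (\<Sum>i\<in>UNIV. x i \<bullet> (Q i *v x i))"
        by (auto simp: neg_def_iff)
    qed
  next
    assume R: ?R
    have "z \<bullet> (?M *v z) < 0" if z: "z \<noteq> 0" for z
    proof -
      define x where x: "x = (\<lambda>i. \<chi> r. z $ (i, r))"
      obtain k r where "z $ (k, r) \<noteq> 0"
        using z by (auto simp: vec_eq_iff)
      then have "x k \<noteq> 0"
        by (auto simp: x vec_eq_iff)
      with R form[OF x refl] show ?thesis
        by auto
    qed
    with sym show "neg_def ?M"
      by (simp add: neg_def_iff)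
  qed
qed

section \<open>The conditions as inequalities between vectors\<close>

text \<open>The factors \<open>\<tau>\<^sub>i\<close> are absorbed into \<open>\<tau>\<^sub>i A\<^sub>i\<close> here, so that the arguments below see a
  single family of matrices.\<close>

lemma cond_a'_iff:
  fixes A :: "'k::finite \<Rightarrow> real ^ 'n ^ 'n"
  shows "cond_a' A \<tau> \<longleftrightarrow> (\<exists>Q. (\<forall>i. pos_def (Q i)) \<and>
    (\<forall>i v. v \<noteq> 0 \<longrightarrow> real CARD('k) *
      (((\<tau> i *\<^sub>R A i) *v v) \<bullet> ((\<Sum>j\<in>UNIV. Q j) *v ((\<tau> i *\<^sub>R A i) *v v))) < v \<bullet> (Q i *v v)))"
proof -
  have "neg_def ((real CARD('k) * (\<tau> i)\<^sup>2) *\<^sub>R (transpose (A i) ** (\<Sum>j\<in>UNIV. Q j) ** A i) - Q i)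
      \<longleftrightarrow> (\<forall>v. v \<noteq> 0 \<longrightarrow> real CARD('k) *
        (((\<tau> i *\<^sub>R A i) *v v) \<bullet> ((\<Sum>j\<in>UNIV. Q j) *v ((\<tau> i *\<^sub>R A i) *v v))) < v \<bullet> (Q i *v v))"
    (is "neg_def ?M \<longleftrightarrow> ?R")
    if "\<And>i. pos_def (Q i)" for Q :: "'k \<Rightarrow> real ^ 'n ^ 'n" and i
  proof -
    have sum_sym: "transpose (\<Sum>j\<in>UNIV. Q j) = (\<Sum>j\<in>UNIV. Q j)"
      by (rule pos_def_symmetric[OF pos_def_sum[OF that]])
    have "transpose ?M = ?M"
      by (simp only: transpose_diff transpose_scalar matrix_transpose_mul transpose_transpose
          sum_sym matrix_mul_assoc pos_def_symmetric[OF that])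
    moreover have "v \<bullet> (?M *v v) = real CARD('k) *
        (((\<tau> i *\<^sub>R A i) *v v) \<bullet> ((\<Sum>j\<in>UNIV. Q j) *v ((\<tau> i *\<^sub>R A i) *v v))) - v \<bullet> (Q i *v v)" for v
      by (simp add: matrix_vector_mult_diff_rdistrib scaleR_matrix_vector_assoc[symmetric]
          matrix_vector_mul_assoc[symmetric] inner_diff_right inner_transpose_right
          matrix_vector_mult_scaleR power2_eq_square)
    ultimately show ?thesis
      by (simp add: neg_def_iff)
  qed
  then show ?thesis
    unfolding cond_a'_def by blast
qed

lemma cond_b_iff:
  fixes A :: "'k::finite \<Rightarrow> real ^ 'n ^ 'n"
  shows "cond_b A \<tau> \<longleftrightarrow> (\<exists>S Q R. (\<forall>i. pos_def (S i)) \<and> (\<forall>i. pos_def (Q i)) \<and>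
    (\<forall>v. v \<noteq> 0 \<longrightarrow>
      v \<bullet> ((\<Sum>i\<in>UNIV. Q i) *v v) + v \<bullet> ((\<Sum>i\<in>UNIV. S i) *v v) < 2 * (v \<bullet> (R *v v))) \<and>
    (\<forall>i u v. u \<noteq> 0 \<or> v \<noteq> 0 \<longrightarrow>
      2 * (((\<tau> i *\<^sub>R A i) *v u) \<bullet> (R *v v)) < u \<bullet> (S i *v u) + v \<bullet> (Q i *v v)))"
proof -
  have sum_form: "neg_def ((\<Sum>i\<in>UNIV. Q i) + (\<Sum>i\<in>UNIV. S i) - (transpose R + R)) \<longleftrightarrow>
      (\<forall>v. v \<noteq> 0 \<longrightarrow>
        v \<bullet> ((\<Sum>i\<in>UNIV. Q i) *v v) + v \<bullet> ((\<Sum>i\<in>UNIV. S i) *v v) < 2 * (v \<bullet> (R *v v)))"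
    (is "neg_def ?M \<longleftrightarrow> _")
    if "\<And>i. pos_def (S i)" "\<And>i. pos_def (Q i)" for S Q :: "'k \<Rightarrow> real ^ 'n ^ 'n" and R
  proof -
    have "transpose ?M = ?M"
      by (simp add: transpose_simps pos_def_symmetric[OF that(1)] pos_def_symmetric[OF that(2)]
          add.commute)
    moreover have "v \<bullet> (?M *v v) = v \<bullet> ((\<Sum>i\<in>UNIV. Q i) *v v) + v \<bullet> ((\<Sum>i\<in>UNIV. S i) *v v)
        - 2 * (v \<bullet> (R *v v))" for v
      by (simp add: matrix_vector_mult_add_rdistrib matrix_vector_mult_diff_rdistrib
          inner_diff_right inner_add_right inner_transpose_right inner_commute)
    ultimately show ?thesis
      by (simp add: neg_def_iff)
  qed
  have block_form: "neg_def (block2 (- S) (\<tau> i *\<^sub>R (transpose (A i) ** R))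
        (\<tau> i *\<^sub>R (transpose R ** A i)) (- Q)) \<longleftrightarrow>
      (\<forall>u v. u \<noteq> 0 \<or> v \<noteq> 0 \<longrightarrow>
        2 * (((\<tau> i *\<^sub>R A i) *v u) \<bullet> (R *v v)) < u \<bullet> (S *v u) + v \<bullet> (Q *v v))"
    if "pos_def S" "pos_def Q" for S Q R :: "real ^ 'n ^ 'n" and i
  proof -
    have K: "\<tau> i *\<^sub>R (transpose (A i) ** R) = transpose (\<tau> i *\<^sub>R (transpose R ** A i))"
      by (simp add: transpose_simps)
    have inner: "((\<tau> i *\<^sub>R (transpose R ** A i)) *v u) \<bullet> v = ((\<tau> i *\<^sub>R A i) *v u) \<bullet> (R *v v)" for u v
      by (simp add: matrix_vector_simps inner_transpose_right inner_commute[of _ v])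
         (simp add: inner_commute)
    show ?thesis
      unfolding K neg_def_block2_iff[OF pos_def_symmetric[OF that(1)] pos_def_symmetric[OF that(2)]]
        inner ..
  qed
  show ?thesis
    unfolding cond_b_def
    by (intro ex_cong1 conj_cong all_cong1 refl sum_form block_form) blast+
qed

lemma cond_c_iff:
  fixes A :: "'k::finite \<Rightarrow> real ^ 'n ^ 'n"
  shows "cond_c A \<tau> \<longleftrightarrow> (\<exists>Q. (\<forall>i. pos_def (Q i)) \<and>
    (\<forall>x y. (\<exists>i. x i \<noteq> 0) \<longrightarrow> y = (\<Sum>i\<in>UNIV. transpose (\<tau> i *\<^sub>R A i) *v x i) \<longrightarrow>
      y \<bullet> ((\<Sum>i\<in>UNIV. Q i) *v y) < (\<Sum>i\<in>UNIV. x i \<bullet> (Q i *v x i))))"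
proof -
  have "neg_def ((\<Sum>i\<in>UNIV. block_column (\<lambda>j. \<tau> j *\<^sub>R A j) ** Q i **
        transpose (block_column (\<lambda>j. \<tau> j *\<^sub>R A j))) - block_diag Q) \<longleftrightarrow>
      (\<forall>x y. (\<exists>i. x i \<noteq> 0) \<longrightarrow> y = (\<Sum>i\<in>UNIV. transpose (\<tau> i *\<^sub>R A i) *v x i) \<longrightarrow>
        y \<bullet> ((\<Sum>i\<in>UNIV. Q i) *v y) < (\<Sum>i\<in>UNIV. x i \<bullet> (Q i *v x i)))"
    if "\<forall>i. pos_def (Q i)" for Q
    by (rule neg_def_block_column_iff) (simp add: that pos_def_symmetric)
  then show ?thesis
    unfolding cond_c_def by blast
qed

section \<open>The implications\<close>

text \<open>The inequality of (a) for index \<open>i\<close>, multiplied by \<open>\<tau>\<^sub>i > 0\<close>, is that of (a') for the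
  matrices \<open>\<tau>\<^sub>i Q\<^sub>i\<close>, up to the term in \<open>P\<close>.\<close>

lemma cond_a_imp_cond_a':
  fixes A :: "'k::finite \<Rightarrow> real ^ 'n ^ 'n" and \<tau> :: "'k \<Rightarrow> real"
  assumes \<tau>: "\<And>i. \<tau> i > 0" and "cond_a A \<tau>"
  shows "cond_a' A \<tau>"
proof -
  define N where "N = real CARD('k)"
  obtain P Q where P: "pos_def P" and Q: "\<And>i. pos_def (Q i)"
    and neg: "\<And>i. neg_def ((N * \<tau> i) *\<^sub>R
      (transpose (A i) ** (P + (\<Sum>j\<in>UNIV. \<tau> j *\<^sub>R Q j)) ** A i) - Q i)"
    using assms(2) unfolding cond_a_def N_def by blast
  define Z where "Z = (\<Sum>j\<in>UNIV. \<tau> j *\<^sub>R Q j)"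
  have "N * (((\<tau> i *\<^sub>R A i) *v v) \<bullet> (Z *v ((\<tau> i *\<^sub>R A i) *v v))) < v \<bullet> ((\<tau> i *\<^sub>R Q i) *v v)"
    if "v \<noteq> 0" for i v
  proof -
    let ?w = "A i *v v"
    have "N * \<tau> i * (?w \<bullet> (P *v ?w) + ?w \<bullet> (Z *v ?w)) < v \<bullet> (Q i *v v)"
      using neg[of i] that unfolding Z_def[symmetric] neg_def_iff
      by (simp add: matrix_vector_simps inner_diff_right inner_transpose_right inner_add_right)
    moreover have "0 \<le> N * \<tau> i * (?w \<bullet> (P *v ?w))"
      using \<tau>[of i] pos_def_nonneg[OF P] by (simp add: N_def)
    ultimately have "N * \<tau> i * (?w \<bullet> (Z *v ?w)) < v \<bullet> (Q i *v v)"
      by (simp add: distrib_left)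
    from mult_strict_left_mono[OF this \<tau>[of i]] show ?thesis
      by (simp add: scaleR_matrix_vector_assoc[symmetric] matrix_vector_mult_scaleR mult_ac)
  qed
  then show ?thesis
    unfolding cond_a'_iff N_def Z_def
    by (intro exI[of _ "\<lambda>j. \<tau> j *\<^sub>R Q j"]) (auto intro: pos_def_scaleR Q \<tau>)
qed

lemma cond_a'_imp_cond_b:
  fixes A :: "'k::finite \<Rightarrow> real ^ 'n ^ 'n" and \<tau> :: "'k \<Rightarrow> real"
  assumes "cond_a' A \<tau>"
  shows "cond_b A \<tau>"
proof -
  define B where "B = (\<lambda>i. \<tau> i *\<^sub>R A i)"
  define N where "N = real CARD('k)"
  have N: "N > 0"
    by (simp add: N_def)
  obtain Q where Q: "\<And>i. pos_def (Q i)"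
    and less: "\<And>i v. v \<noteq> 0 \<Longrightarrow>
      N * ((B i *v v) \<bullet> ((\<Sum>j\<in>UNIV. Q j) *v (B i *v v))) < v \<bullet> (Q i *v v)"
    using assms unfolding cond_a'_iff B_def N_def by blast
  define Z where "Z = (\<Sum>j\<in>UNIV. Q j)"
  have Z: "pos_def Z"
    unfolding Z_def by (rule pos_def_sum[OF Q])
  \<comment> \<open>Half-way between \<open>N B\<^sub>i\<^sup>T Z B\<^sub>i\<close> and \<open>Q\<^sub>i\<close>, so that both gaps are strict.\<close>
  define S where "S = (\<lambda>i. (1/2) *\<^sub>R (N *\<^sub>R (transpose (B i) ** Z ** B i) + Q i))"
  have S_form: "v \<bullet> (S i *v v) =
      (N * ((B i *v v) \<bullet> (Z *v (B i *v v))) + v \<bullet> (Q i *v v)) / 2" for i v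
    by (simp add: S_def matrix_vector_simps inner_add_right inner_transpose_right)
  have S_upper: "v \<bullet> (S i *v v) < v \<bullet> (Q i *v v)"
    and S_lower: "N * ((B i *v v) \<bullet> (Z *v (B i *v v))) < v \<bullet> (S i *v v)" if "v \<noteq> 0" for i v
    using less[OF that, of i] by (simp_all add: S_form Z_def)
  have S: "pos_def (S i)" for i
  proof -
    have "transpose (S i) = S i"
      by (simp add: S_def transpose_simps matrix_mul_assoc pos_def_symmetric[OF Q]
          pos_def_symmetric[OF Z])
    moreover have "0 \<le> N * ((B i *v v) \<bullet> (Z *v (B i *v v)))" for v
      using N pos_def_nonneg[OF Z] by simp
    ultimately show ?thesis
      unfolding pos_def_def using S_lower by (metis order_le_less_trans)
  qed
  define Q' where "Q' = (\<lambda>_ :: 'k. (1 / N) *\<^sub>R Z)"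
  have Q': "pos_def (Q' i)" for i
    unfolding Q'_def using N by (intro pos_def_scaleR Z) simp
  have sum_Q': "(\<Sum>i\<in>UNIV. Q' i) = Z"
    using N by (simp add: Q'_def sum_constant_scaleR N_def del: sum_constant)
  have sum_ineq: "v \<bullet> ((\<Sum>i\<in>UNIV. Q' i) *v v) + v \<bullet> ((\<Sum>i\<in>UNIV. S i) *v v) < 2 * (v \<bullet> (Z *v v))"
    if "v \<noteq> 0" for v
  proof -
    have "(\<Sum>i\<in>UNIV. v \<bullet> (S i *v v)) < (\<Sum>i\<in>UNIV. v \<bullet> (Q i *v v))"
      by (intro sum_strict_mono S_upper that) auto
    then show ?thesis
      unfolding sum_Q' by (simp add: Z_def sum_matrix_vector_mult inner_sum_right)
  qed
  have block_ineq: "2 * ((B i *v u) \<bullet> (Z *v v)) < u \<bullet> (S i *v u) + v \<bullet> (Q' i *v v)"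
    if "u \<noteq> 0 \<or> v \<noteq> 0" for i u v
  proof (cases "u = 0")
    case True
    then show ?thesis
      using that N pos_def_pos[OF Z, of v] by (simp add: Q'_def scaleR_matrix_vector_assoc[symmetric])
  next
    case False
    \<comment> \<open>The scaling by \<open>N\<close> balances the two terms so that \<open>v\<close> is charged only \<open>Z / N\<close>, which is
      what \<open>N\<close> blocks can afford.\<close>
    have "2 * ((B i *v u) \<bullet> (Z *v v)) \<le>
        N * ((B i *v u) \<bullet> (Z *v (B i *v u))) + (1 / N) * (v \<bullet> (Z *v v))"
      using pos_def_young[OF Z, of "N *\<^sub>R (B i *v u)" v] N
      by (simp add: matrix_vector_mult_scaleR field_simps)
    with S_lower[OF False, of i] show ?thesis
      by (simp add: Q'_def scaleR_matrix_vector_assoc[symmetric])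
  qed
  show ?thesis
    unfolding cond_b_iff B_def[THEN fun_cong, symmetric]
    using S Q' sum_ineq block_ineq by blast
qed

lemma cond_b_imp_cond_c:
  fixes A :: "'k::finite \<Rightarrow> real ^ 'n ^ 'n" and \<tau> :: "'k \<Rightarrow> real"
  assumes "cond_b A \<tau>"
  shows "cond_c A \<tau>"
proof -
  define B where "B = (\<lambda>i. \<tau> i *\<^sub>R A i)"
  obtain S Q R where S: "\<And>i. pos_def (S i)" and Q: "\<And>i. pos_def (Q i)"
    and sum_ineq: "\<And>v. v \<noteq> 0 \<Longrightarrow>
      v \<bullet> ((\<Sum>i\<in>UNIV. Q i) *v v) + v \<bullet> ((\<Sum>i\<in>UNIV. S i) *v v) < 2 * (v \<bullet> (R *v v))"
    and block_ineq: "\<And>i u v. u \<noteq> 0 \<or> v \<noteq> 0 \<Longrightarrow>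
      2 * ((B i *v u) \<bullet> (R *v v)) < u \<bullet> (S i *v u) + v \<bullet> (Q i *v v)"
    using assms unfolding cond_b_iff B_def by blast
  have "0 < v \<bullet> (R *v v)" if "v \<noteq> 0" for v
    using sum_ineq[OF that] pos_def_nonneg[OF pos_def_sum[of Q, OF Q], of v]
      pos_def_nonneg[OF pos_def_sum[of S, OF S], of v] by linarith
  then obtain T where "T ** R = mat 1" and "R ** T = mat 1"
    using positive_form_inverse by blast
  then have RT: "R *v (T *v v) = v" for v
    by (simp add: matrix_vector_mul_assoc)
  define W where "W = (\<lambda>i. transpose T ** Q i ** T)"
  have W: "pos_def (W i)" for i
    unfolding W_def by (rule pos_def_congruence[OF Q]) (metis RT matrix_vector_mult_0_right)
  have W_form: "v \<bullet> (W i *v v) = (T *v v) \<bullet> (Q i *v (T *v v))" for i v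
    by (simp add: W_def matrix_vector_simps inner_transpose_right)
  have "y \<bullet> ((\<Sum>i\<in>UNIV. W i) *v y) < (\<Sum>i\<in>UNIV. x i \<bullet> (W i *v x i))"
    if x: "\<exists>i. x i \<noteq> 0" and y: "y = (\<Sum>i\<in>UNIV. transpose (B i) *v x i)" for x y
  proof -
    \<comment> \<open>The choice \<open>R u = y\<close> makes \<open>2 (u \<bullet> y)\<close> the right-hand side of the sum inequality.\<close>
    define u where "u = T *v y"
    obtain k where "x k \<noteq> 0"
      using x by blast
    then have k: "T *v x k \<noteq> 0"
      by (metis RT matrix_vector_mult_0_right)
    have le: "2 * ((B i *v u) \<bullet> x i) \<le> u \<bullet> (S i *v u) + x i \<bullet> (W i *v x i)" for i
      using block_ineq[of u "T *v x i" i]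
      by (cases "u = 0 \<and> T *v x i = 0") (auto simp: RT W_form)
    have "2 * (u \<bullet> y) = (\<Sum>i\<in>UNIV. 2 * ((B i *v u) \<bullet> x i))"
      by (simp add: y inner_sum_right inner_transpose_right sum_distrib_left)
    also have "\<dots> < (\<Sum>i\<in>UNIV. u \<bullet> (S i *v u) + x i \<bullet> (W i *v x i))"
      using le block_ineq[of u "T *v x k" k] k
      by (intro sum_strict_mono_ex1) (auto simp: RT W_form intro!: bexI[of _ k])
    also have "\<dots> = u \<bullet> ((\<Sum>i\<in>UNIV. S i) *v u) + (\<Sum>i\<in>UNIV. x i \<bullet> (W i *v x i))"
      by (simp add: sum.distrib sum_matrix_vector_mult inner_sum_right)
    finally have upper:
      "2 * (u \<bullet> y) < u \<bullet> ((\<Sum>i\<in>UNIV. S i) *v u) + (\<Sum>i\<in>UNIV. x i \<bullet> (W i *v x i))" .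
    have "u \<bullet> ((\<Sum>i\<in>UNIV. Q i) *v u) + u \<bullet> ((\<Sum>i\<in>UNIV. S i) *v u) \<le> 2 * (u \<bullet> y)"
      using sum_ineq[of u] by (cases "u = 0") (auto simp: u_def RT)
    moreover have "y \<bullet> ((\<Sum>i\<in>UNIV. W i) *v y) = u \<bullet> ((\<Sum>i\<in>UNIV. Q i) *v u)"
      by (simp add: sum_matrix_vector_mult inner_sum_right W_form u_def)
    ultimately show ?thesis
      using upper by linarith
  qed
  with W show ?thesis
    unfolding cond_c_iff B_def by blast
qed

lemma cond_c_imp_cond_b:
  fixes A :: "'k::finite \<Rightarrow> real ^ 'n ^ 'n" and \<tau> :: "'k \<Rightarrow> real"
  assumes "cond_c A \<tau>"
  shows "cond_b A \<tau>"
proof -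
  define B where "B = (\<lambda>i. \<tau> i *\<^sub>R A i)"
  define N where "N = real CARD('k)"
  have N: "N > 0"
    by (simp add: N_def)
  obtain Q where Q: "\<And>i. pos_def (Q i)"
    and less: "\<And>x. \<exists>i. x i \<noteq> 0 \<Longrightarrow>
      (\<Sum>i\<in>UNIV. transpose (B i) *v x i) \<bullet>
        ((\<Sum>i\<in>UNIV. Q i) *v (\<Sum>i\<in>UNIV. transpose (B i) *v x i)) <
      (\<Sum>i\<in>UNIV. x i \<bullet> (Q i *v x i))"
    using assms unfolding cond_c_iff B_def by blast
  define W where "W = (\<Sum>i\<in>UNIV. Q i)"
  have W: "pos_def W"
    unfolding W_def by (rule pos_def_sum[OF Q])
  obtain R where R: "pos_def R" and WR: "\<And>v. W *v (R *v v) = v"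
    using pos_def_inverse[OF W] by blast
  obtain T where "\<forall>i. pos_def (T i) \<and> (\<forall>v. Q i *v (T i *v v) = v)"
    using pos_def_inverse[OF Q] by metis
  then have T: "\<And>i. pos_def (T i)" and QT: "\<And>i v. Q i *v (T i *v v) = v"
    by blast+
  define X where "X = (\<lambda>i. transpose (B i) ** T i ** B i)"
  have X_form: "v \<bullet> (X i *v v) = (B i *v v) \<bullet> (T i *v (B i *v v))" for i v
    by (simp add: X_def matrix_vector_simps inner_transpose_right)
  have X_sym: "transpose (X i) = X i" for i
    by (simp add: X_def transpose_simps matrix_mul_assoc pos_def_symmetric[OF T])
  define M where "M = R - (\<Sum>i\<in>UNIV. X i)"
  \<comment> \<open>Condition (c) at \<open>x\<^sub>i = Q\<^sub>i\<^sup>-\<^sup>1 B\<^sub>i v\<close>, for which \<open>\<Sum>\<^sub>i B\<^sub>i\<^sup>T x\<^sub>i\<close> is the value at \<open>v\<close> of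
    \<open>\<Sum>\<^sub>i B\<^sub>i\<^sup>T Q\<^sub>i\<^sup>-\<^sup>1 B\<^sub>i\<close>.\<close>
  have "0 < v \<bullet> (M *v v)" if "v \<noteq> 0" for v
  proof -
    define x where "x = (\<lambda>i. T i *v (B i *v v))"
    define y where "y = (\<Sum>i\<in>UNIV. transpose (B i) *v x i)"
    have y: "y = (\<Sum>i\<in>UNIV. X i) *v v"
      by (simp add: y_def x_def X_def sum_matrix_vector_mult matrix_vector_mul_assoc matrix_mul_assoc)
    have vy: "v \<bullet> y = (\<Sum>i\<in>UNIV. x i \<bullet> (Q i *v x i))"
      by (simp add: y sum_matrix_vector_mult inner_sum_right X_form x_def QT inner_commute)
    have "v \<bullet> y < v \<bullet> (R *v v)"
    proof (cases "\<exists>i. x i \<noteq> 0")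
      case True
      then have "y \<bullet> (W *v y) < v \<bullet> y"
        unfolding vy using less[of x] by (simp add: W_def y_def)
      moreover have "2 * (v \<bullet> y) \<le> v \<bullet> (R *v v) + y \<bullet> (W *v y)"
        by (rule pos_def_young_dual[OF W WR])
      ultimately show ?thesis
        by linarith
    next
      case False
      then show ?thesis
        using pos_def_pos[OF R that] by (simp add: vy)
    qed
    then show ?thesis
      by (simp add: M_def y matrix_vector_mult_diff_rdistrib inner_diff_right)
  qed
  then have M: "pos_def M"
    by (simp add: pos_def_def) (simp add: M_def transpose_simps X_sym pos_def_symmetric[OF R])
  \<comment> \<open>All \<open>S i\<close> together use up half of the slack \<open>M\<close>.\<close>
  define S where "S = (\<lambda>i. X i + (1 / (2 * N)) *\<^sub>R M)"
  have S_form: "v \<bullet> (S i *v v) = v \<bullet> (X i *v v) + (v \<bullet> (M *v v)) / (2 * N)" for i v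
    by (simp add: S_def matrix_vector_mult_add_rdistrib scaleR_matrix_vector_assoc[symmetric]
        inner_add_right)
  have slack_pos: "0 < (v \<bullet> (M *v v)) / (2 * N)" if "v \<noteq> 0" for v
    using pos_def_pos[OF M that] N by simp
  have S: "pos_def (S i)" for i
  proof -
    have "transpose (S i) = S i"
      by (simp add: S_def transpose_simps X_sym pos_def_symmetric[OF M])
    moreover have "0 < v \<bullet> (S i *v v)" if "v \<noteq> 0" for v
      using slack_pos[OF that] pos_def_nonneg[OF T, of "B i *v v" i] by (simp add: S_form X_form)
    ultimately show ?thesis
      by (simp add: pos_def_def)
  qed
  \<comment> \<open>The sum of these matrices is \<open>R W R = R\<close>.\<close>
  define Q' where "Q' = (\<lambda>i. transpose R ** Q i ** R)"
  have Q': "pos_def (Q' i)" for i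
    unfolding Q'_def by (rule pos_def_congruence[OF Q]) (metis WR matrix_vector_mult_0_right)
  have Q'_form: "v \<bullet> (Q' i *v v) = (R *v v) \<bullet> (Q i *v (R *v v))" for i v
    by (simp add: Q'_def matrix_vector_simps inner_transpose_right)
  have sum_ineq: "v \<bullet> ((\<Sum>i\<in>UNIV. Q' i) *v v) + v \<bullet> ((\<Sum>i\<in>UNIV. S i) *v v) < 2 * (v \<bullet> (R *v v))"
    if "v \<noteq> 0" for v
  proof -
    have "v \<bullet> ((\<Sum>i\<in>UNIV. Q' i) *v v) = (R *v v) \<bullet> (W *v (R *v v))"
      by (simp add: sum_matrix_vector_mult inner_sum_right Q'_form W_def)
    then have "v \<bullet> ((\<Sum>i\<in>UNIV. Q' i) *v v) = v \<bullet> (R *v v)"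
      by (simp add: WR inner_commute)
    moreover have "v \<bullet> ((\<Sum>i\<in>UNIV. S i) *v v) =
        v \<bullet> ((\<Sum>i\<in>UNIV. X i) *v v) + (v \<bullet> (M *v v)) / 2"
      using N by (simp add: sum_matrix_vector_mult inner_sum_right S_form sum.distrib N_def)
    moreover have "v \<bullet> (M *v v) = v \<bullet> (R *v v) - v \<bullet> ((\<Sum>i\<in>UNIV. X i) *v v)"
      by (simp add: M_def matrix_vector_mult_diff_rdistrib inner_diff_right)
    ultimately show ?thesis
      using pos_def_pos[OF M that] by linarith
  qed
  have block_ineq: "2 * ((B i *v u) \<bullet> (R *v v)) < u \<bullet> (S i *v u) + v \<bullet> (Q' i *v v)"
    if "u \<noteq> 0 \<or> v \<noteq> 0" for i u v
  proof (cases "u = 0")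
    case True
    then show ?thesis
      using that pos_def_pos[OF Q', of v i] by simp
  next
    case False
    have "2 * ((B i *v u) \<bullet> (R *v v)) \<le> u \<bullet> (X i *v u) + v \<bullet> (Q' i *v v)"
      unfolding X_form Q'_form by (rule pos_def_young_dual[OF Q QT])
    with slack_pos[OF False] show ?thesis
      by (simp add: S_form)
  qed
  show ?thesis
    unfolding cond_b_iff B_def[THEN fun_cong, symmetric]
    using S Q' sum_ineq block_ineq by blast
qed

theorem proposition1:
  fixes A :: "'k::finite \<Rightarrow> real ^ 'n ^ 'n" and \<tau> :: "'k \<Rightarrow> real"
  assumes "\<And>i. \<tau> i > 0"
  shows "(cond_a A \<tau> \<longrightarrow> cond_b A \<tau>) \<and>
         (cond_a' A \<tau> \<longrightarrow> cond_b A \<tau>) \<and>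
         (cond_b A \<tau> \<longleftrightarrow> cond_c A \<tau>) \<and>
         (cond_a A \<tau> \<longrightarrow> cond_b A \<tau> \<and> cond_c A \<tau>)"
  using cond_a_imp_cond_a'[of \<tau> A, OF assms] cond_a'_imp_cond_b[of A \<tau>]
    cond_b_imp_cond_c[of A \<tau>] cond_c_imp_cond_b[of A \<tau>]
  by blast

end
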